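(* Let $\mu\in\mathbb{R}$, $\beta>0$, $\kappa>0$, and let $X\sim\mathcal{ALSM}(\mu,\beta,\kappa,\boldsymbol{\theta})$ be an asymmetric Laplace scale mixture random variable with mixing probability density (or mass) function $h(\cdot;\boldsymbol{\theta})$ supported in $S_h\subseteq(0,\infty)$. Let $Z$, $V$, $W$ be independent random variables such that $Z\sim\mathcal{N}(0,1)$ is standard normal, $V$ is standard exponential (rate $1$), and $W$ has probability density (or mass) function $h(\cdot;\boldsymbol{\theta})$. Then $$X\stackrel{d}{=}\mu+\beta\left(\frac{1}{\kappa}-\kappa\right)\frac{V}{W}+\beta\,\frac{\sqrt{2V}}{W}\,Z,$$ where $\stackrel{d}{=}$ denotes equality in distribution.
   Context: For $\mu\in\mathbb{R}$, $\beta>0$, $\kappa>0$, the asymmetric Laplace density is $$f_{\mathrm{AL}}(x;\mu,\beta,\kappa)=\frac{1}{\beta}\,\frac{\kappa}{1+\kappa^2}\begin{cases} e^{-\frac{\kappa}{\beta}(x-\mu)}, & x\ge\mu,\\ e^{-\frac{1}{\kappa\beta}(\mu-x)}, & x<\mu.\end{cases}$$ The function $h(\cdot;\boldsymbol{\theta})$ is a probability density function (with respect to Lebesgue measure) or a probability mass function, depending on a parameter vector $\boldsymbol{\theta}$, whose support $S_h$ is contained in $(0,\infty)$. A real random variable $X$ has the asymmetric Laplace scale mixture distribution $\mathcal{ALSM}(\mu,\beta,\kappa,\boldsymbol{\theta})$ if it has probability density function $$f_{\mathrm{ALSM}}(x;\mu,\beta,\kappa,\boldsymbol{\theta})=\int_{S_h}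 f_{\mathrm{AL}}(x;\mu,\beta/w,\kappa)\,h(w;\boldsymbol{\theta})\,dw,\qquad x\in\mathbb{R},$$ where in the discrete case the integral over $S_h$ is read as the sum $\sum_{w\in S_h}$. *)

theory Defs
  imports "HOL-Probability.Probability"
begin

definition AL_density :: "real \<Rightarrow> real \<Rightarrow> real \<Rightarrow> real \<Rightarrow> real" where
  "AL_density \<mu> \<beta> \<kappa> x =
     1 / \<beta> * (\<kappa> / (1 + \<kappa>\<^sup>2)) *
     (if x \<ge> \<mu> then exp (- (\<kappa> / \<beta>) * (x - \<mu>)) else exp (- (1 / (\<kappa> * \<beta>)) * (\<mu> - x)))"

text \<open>
  A mixing function is either a Lebesgue density or a probability mass function.  It is
  integrated against Lebesgue measure or counting measure, respectively; an integral with
  respect to the latter is the sum.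
\<close>

datatype mixing_kind = Density | Mass

definition mixing_base :: "mixing_kind \<Rightarrow> real measure" where
  "mixing_base k = (case k of Density \<Rightarrow> lborel | Mass \<Rightarrow> count_space UNIV)"

text \<open>
  The set where the function does not vanish, without taking the closure: a Gamma density is
  supported in the open half-line in this sense.
\<close>

definition mixing_support :: "(real \<Rightarrow> real) \<Rightarrow> real set" where
  "mixing_support h = {w. h w \<noteq> 0}"

definition mixing_function :: "mixing_kind \<Rightarrow> (real \<Rightarrow> real) \<Rightarrow> bool" where
  "mixing_function k h \<longleftrightarrow>
     h \<in> borel_measurable (mixing_base k) \<and> (\<forall>w. 0 \<le> h w) \<and>
     (\<integral>\<^sup>+ w. ennreal (h w) \<partial>mixing_base k) = 1 \<and>
     mixing_support h \<subseteq> {0<..}"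

text \<open>
  In the discrete case the law is given by point probabilities of a Borel random variable;
  \<^const>\<open>distributed\<close> with respect to counting measure would demand measurability of the
  preimages of all sets of reals.
\<close>

definition has_mixing_law :: "mixing_kind \<Rightarrow> 'a measure \<Rightarrow> ('a \<Rightarrow> real) \<Rightarrow> (real \<Rightarrow> real) \<Rightarrow> bool" where
  "has_mixing_law k M W h \<longleftrightarrow>
     (case k of
        Density \<Rightarrow> distributed M lborel W (\<lambda>w. ennreal (h w))
      | Mass \<Rightarrow> W \<in> borel_measurable M \<and> (\<forall>w. measure M {\<omega> \<in> space M. W \<omega> = w} = h w))"

text \<open>
  The density takes values in the extended non-negative reals because it is infinite at
  \<open>x = \<mu>\<close> when the mixing distribution has infinite mean.
\<close>

definition ALSM_density ::
  "mixing_kind \<Rightarrow> real \<Rightarrow> real \<Rightarrow> real \<Rightarrow> (real \<Rightarrow> real) \<Rightarrow> real \<Rightarrow> ennreal" where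
  "ALSM_density k \<mu> \<beta> \<kappa> h x =
     (\<integral>\<^sup>+ w \<in> mixing_support h. ennreal (AL_density \<mu> (\<beta> / w) \<kappa> x * h w) \<partial>mixing_base k)"

definition has_ALSM_law ::
  "mixing_kind \<Rightarrow> 'a measure \<Rightarrow> ('a \<Rightarrow> real) \<Rightarrow> real \<Rightarrow> real \<Rightarrow> real \<Rightarrow> (real \<Rightarrow> real) \<Rightarrow> bool" where
  "has_ALSM_law k M X \<mu> \<beta> \<kappa> h \<longleftrightarrow> distributed M lborel X (ALSM_density k \<mu> \<beta> \<kappa> h)"

end

theory Submission imports Defs begin

text \<open>
  Conditioning on \<open>V\<close>, the variable \<open>Y = (1/\<kappa> - \<kappa>) V + sqrt (2V) Z\<close> has characteristic function
  \<open>E (exp ((\<i>t (1/\<kappa> - \<kappa>) - t\<^sup>2) V)) = 1 / (1 + t\<^sup>2 - \<i>t (1/\<kappa> - \<kappa>))\<close>.  Its denominator factors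
  as \<open>(\<kappa> - \<i>t) (1/\<kappa> + \<i>t)\<close>, and the partial fractions are the contributions of the two branches
  of the density \<open>AL(0, 1, \<kappa>)\<close>, so this is the density of \<open>Y\<close>.  Given \<open>W = w\<close>, the
  variable \<open>\<mu> + \<beta> Y / w\<close> then has density \<open>AL(\<mu>, \<beta>/w, \<kappa>)\<close>, and averaging over the law of \<open>W\<close>
  gives the mixture density.
\<close>

section \<open>Characteristic function of the asymmetric Laplace density\<close>

text \<open>The norm of the integrand is the real exponential of rate \<open>Re a\<close>, which
  gives integrability and decay at infinity; the antiderivative \<open>- ?f x / a\<close> then runs
  from -1/a to 0. Both branches of the Laplace density and the expectation over \<open>V\<close>
  reduce to this integral.\<close>

lemma has_bochner_integral_exp_Ioi:
  fixes a :: complex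
  assumes a: "Re a > 0"
  shows "has_bochner_integral lborel (\<lambda>x. indicator {0<..} x *\<^sub>R exp (- (a * of_real x))) (1 / a)"
proof -
  let ?f = "\<lambda>x::real. exp (- (a * of_real x))"
  have a0: "a \<noteq> 0" using a by auto
  have meas: "?f \<in> borel_measurable borel"
    by (intro borel_measurable_continuous_onI continuous_intros)
  have int: "set_integrable lborel {0<..} ?f"
    unfolding set_integrable_def
  proof (rule Bochner_Integration.integrable_bound)
    show "integrable lborel (\<lambda>x. indicator {0<..} x *\<^sub>R exp (- (x * Re a)))"
      using integrable_I0i_exp_mscale[OF a] by (simp add: set_integrable_def)
    show "(\<lambda>x. indicator {0<..} x *\<^sub>R ?f x) \<in> borel_measurable lborel"
      using meas by measurable
  qed (auto simp: indicator_def mult.commute)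
  have lim: "(?f \<longlongrightarrow> 0) at_top"
  proof (rule tendsto_norm_zero_cancel)
    show "((\<lambda>x. norm (?f x)) \<longlongrightarrow> 0) at_top"
      using a by simp real_asymp
  qed
  have "(LBINT x=ereal 0..\<infinity>. ?f x) = 0 - (- 1 / a)"
  proof (rule interval_integral_FTC_integrable[where F="\<lambda>x. - ?f x / a"])
    show "((\<lambda>x. - ?f x / a) has_vector_derivative ?f x) (at x)" for x
      using a0 by (auto intro!: derivative_eq_intros has_vector_derivative_real_field)
    show "isCont ?f x" for x by (intro continuous_intros)
    show "set_integrable lborel (einterval (ereal 0) \<infinity>) ?f"
      using int by (simp add: einterval_eq_Icc einterval_def greaterThan_def)
    have "((\<lambda>x. - ?f x / a) \<longlongrightarrow> - ?f 0 / a) (at_right 0)"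
      using a0 by (intro tendsto_intros) auto
    then show "(((\<lambda>x. - ?f x / a) \<circ> real_of_ereal) \<longlongrightarrow> - 1 / a) (at_right (ereal 0))"
      by (simp add: ereal_tendsto_simps1)
    have "((\<lambda>x. - ?f x / a) \<longlongrightarrow> - 0 / a) at_top"
      using a0 by (intro tendsto_intros lim) auto
    then show "(((\<lambda>x. - ?f x / a) \<circ> real_of_ereal) \<longlongrightarrow> 0) (at_left \<infinity>)"
      by (simp add: ereal_tendsto_simps1)
  qed simp
  then have "(LBINT x:{0<..}. ?f x) = 1 / a"
    by (simp add: interval_integral_to_infinity_eq)
  with int show ?thesis
    by (simp add: has_bochner_integral_iff set_integrable_def set_lebesgue_integral_def)
qed

lemma AL_density_measurable [measurable]: "AL_density \<mu> \<beta> \<kappa> \<in> borel_measurable borel"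
  unfolding AL_density_def[abs_def] by measurable

lemma AL_density_nonneg: "\<beta> > 0 \<Longrightarrow> \<kappa> > 0 \<Longrightarrow> AL_density \<mu> \<beta> \<kappa> x \<ge> 0"
  by (simp add: AL_density_def)

text \<open>The location-scale property: for \<open>b > 0\<close>, the branch at \<mu> + b y is
  decided by the sign of y, and the factor \<open>b\<close> is the Jacobian of this
  substitution.\<close>

lemma AL_density_affine:
  assumes "b > 0"
  shows "b * AL_density \<mu> b \<kappa> (\<mu> + b * y) = AL_density 0 1 \<kappa> y"
  using assms by (auto simp: AL_density_def zero_le_mult_iff mult_le_0_iff)

text \<open>Splitting at 0 gives two exponential integrals: rate \<open>?a\<close> = \<kappa> - it
  on the right and, after the reflection of x to -x, rate \<open>?b\<close> = 1/\<kappa> + it on the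
  left.\<close>

lemma has_bochner_integral_AL_iexp:
  assumes k: "\<kappa> > 0"
  shows "has_bochner_integral lborel (\<lambda>x. AL_density 0 1 \<kappa> x *\<^sub>R iexp (t * x))
           (1 / (1 + t\<^sup>2 - \<i> * t * (1 / \<kappa> - \<kappa>)))"
proof -
  let ?C = "\<kappa> / (1 + \<kappa>\<^sup>2)"
  let ?a = "Complex \<kappa> (- t)" and ?b = "Complex (1 / \<kappa>) t"
  let ?g = "\<lambda>c x. indicator {0<..} x *\<^sub>R exp (- (c * complex_of_real x))"
  have neg: "has_bochner_integral lborel (\<lambda>x. ?g ?b (- x)) (1 / ?b)"
    using lborel_has_bochner_integral_real_affine_iff[of "-1" "?g ?b" "1 / ?b" 0]
      has_bochner_integral_exp_Ioi[of ?b] k by simp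
  have "has_bochner_integral lborel (\<lambda>x. ?C *\<^sub>R (?g ?a x + ?g ?b (- x))) (?C *\<^sub>R (1 / ?a + 1 / ?b))"
    using k by (intro has_bochner_integral_scaleR_right has_bochner_integral_add neg
        has_bochner_integral_exp_Ioi) auto
  also have "?this \<longleftrightarrow> has_bochner_integral lborel (\<lambda>x. AL_density 0 1 \<kappa> x *\<^sub>R iexp (t * x)) (?C *\<^sub>R (1 / ?a + 1 / ?b))"
  proof (rule has_bochner_integral_cong_AE)
    \<comment> \<open>The point 0 is excluded: both open indicators vanish there, while the density
      takes the value \<open>?C\<close>.\<close>
    show "AE x in lborel. ?C *\<^sub>R (?g ?a x + ?g ?b (- x)) = AL_density 0 1 \<kappa> x *\<^sub>R iexp (t * x)"
      using AE_lborel_singleton[of 0]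
    proof eventually_elim
      case (elim x)
      have 1: "exp (- (?a * complex_of_real x)) = exp (- \<kappa> * x) *\<^sub>R iexp (t * x)"
        unfolding scaleR_conv_of_real exp_of_real[symmetric] exp_add[symmetric]
        by (rule arg_cong[where f=exp]) (simp add: complex_eq_iff)
      have 2: "exp (?b * complex_of_real x) = exp (x / \<kappa>) *\<^sub>R iexp (t * x)"
        unfolding scaleR_conv_of_real exp_of_real[symmetric] exp_add[symmetric]
        by (rule arg_cong[where f=exp]) (simp add: complex_eq_iff)
      show ?case
        using elim by (cases "x > 0") (auto simp: AL_density_def 1 2 indicator_def)
    qed
  qed simp_all
  also have "?C *\<^sub>R (1 / ?a + 1 / ?b) = 1 / (1 + t\<^sup>2 - \<i> * t * (1 / \<kappa> - \<kappa>))"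
  proof -
    have nz: "?a \<noteq> 0" "?b \<noteq> 0" using k by (auto simp: complex_eq_iff)
    \<comment> \<open>The rates add up to the reciprocal of the normalising constant, so over the
      common denominator only the product of the rates remains.\<close>
    have ab: "?a + ?b = of_real (1 / ?C)" 
      using k by (auto simp: complex_eq_iff field_simps power2_eq_square)
    have "?C \<noteq> 0" using k by (simp add: add_pos_nonneg less_imp_neq[symmetric])
    then have C: "complex_of_real ?C * of_real (1 / ?C) = 1"
      unfolding of_real_mult[symmetric] by simp
    have "?C *\<^sub>R (1 / ?a + 1 / ?b) = of_real ?C * ((?a + ?b) / (?a * ?b))"
      using nz by (simp add: scaleR_conv_of_real field_simps)
    also have "\<dots> = 1 / (?a * ?b)"
      unfolding ab times_divide_eq_right C ..
    also have "?a * ?b = 1 + t\<^sup>2 - \<i> * t * (1 / \<kappa> - \<kappa>)"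
      using k by (auto simp: complex_eq_iff power2_eq_square field_simps)
    finally show ?thesis .
  qed
  finally show ?thesis by simp
qed

text \<open>The total mass is the transform at frequency 0.\<close>

lemma nn_integral_AL_density:
  assumes k: "\<kappa> > 0"
  shows "(\<integral>\<^sup>+x. AL_density 0 1 \<kappa> x \<partial>lborel) = 1"
proof -
  have "has_bochner_integral lborel (\<lambda>x. Re (AL_density 0 1 \<kappa> x *\<^sub>R iexp (0 * x))) 1"
    using has_bochner_integral_bounded_linear[OF bounded_linear_Re
        has_bochner_integral_AL_iexp[OF k, of 0]] by simp
  then have "has_bochner_integral lborel (AL_density 0 1 \<kappa>) 1" by simp
  then show ?thesis
    using k by (subst nn_integral_eq_integral) (auto simp: has_bochner_integral_iff AL_density_nonneg)
qed

section \<open>The law of the normal-exponential mixture, before division by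
  \<open>W\<close>\<close>

text \<open>Both sides are probability laws on the real line, so by Levy's uniqueness theorem it
  suffices to match characteristic functions.\<close>

lemma (in prob_space) normal_exponential_mixture:
  assumes k: "\<kappa> > 0"
    and ind: "indep_var borel Z borel V"
    and Z: "distributed M lborel Z (\<lambda>z. ennreal (std_normal_density z))"
    and V: "distributed M lborel V (\<lambda>v. ennreal (exponential_density 1 v))"
  shows "distr M borel (\<lambda>\<omega>. (1 / \<kappa> - \<kappa>) * V \<omega> + sqrt (2 * V \<omega>) * Z \<omega>) =
         density lborel (AL_density 0 1 \<kappa>)" (is "distr M borel ?Y = ?D")
proof (rule Levy_uniqueness)
  have [measurable]: "Z \<in> borel_measurable M" "V \<in> borel_measurable M"
    using Z V by (auto simp: distributed_def)
  show "real_distribution (distr M borel ?Y)"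
    by (intro real_distribution_distr) simp
  show "real_distribution ?D"
    unfolding real_distribution_def real_distribution_axioms_def
    by (auto intro!: prob_spaceI simp: emeasure_density nn_integral_AL_density k)
  let ?c = "1 / \<kappa> - \<kappa>"
  have dZ: "distr M borel Z = std_normal_distribution"
    using Z by (simp add: distributed_def cong: distr_cong)
  have dV: "distr M borel V = density lborel (exponential_density 1)"
    using V by (simp add: distributed_def cong: distr_cong)
  interpret PZ: prob_space "distr M borel Z" by (rule prob_space_distr) simp
  interpret PV: prob_space "distr M borel V" by (rule prob_space_distr) simp
  interpret PP: pair_prob_space "distr M borel Z" "distr M borel V" ..
  show "char (distr M borel ?Y) = char ?D"
  proof
    fix t :: real
    let ?f = "\<lambda>(z, v). iexp (t * (?c * v + sqrt (2 * v) * z))"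
    have fm [measurable]: "?f \<in> borel_measurable (borel \<Otimes>\<^sub>M borel)"
      by measurable
    have "char (distr M borel ?Y) t = (CLINT \<omega>|M. ?f (Z \<omega>, V \<omega>))"
      by (simp add: char_def integral_distr)
    also have "\<dots> = (CLINT p|distr M (borel \<Otimes>\<^sub>M borel) (\<lambda>\<omega>. (Z \<omega>, V \<omega>)). ?f p)"
      by (subst integral_distr) simp_all
    also have "\<dots> = (CLINT p|distr M borel Z \<Otimes>\<^sub>M distr M borel V. ?f p)"
      using ind by (simp add: indep_var_distribution_eq)
    \<comment> \<open>Fubini, with \<open>Z\<close> integrated first, realises the conditioning on
      \<open>V\<close>; the integrand has norm 1, hence is integrable for the product of the two
      laws.\<close>
    also have "\<dots> = (CLINT v|distr M borel V. CLINT z|distr M borel Z. ?f (z, v))"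
    proof -
      have "integrable (distr M borel Z \<Otimes>\<^sub>M distr M borel V) ?f"
        by (rule PP.P.integrable_const_bound[of _ 1]) (auto simp: split_beta simp del: of_real_mult of_real_add)
      from PP.integral_snd[OF this] show ?thesis by simp
    qed
    also have "\<dots> = (CLINT v|distr M borel V. iexp (t * ?c * v) * char std_normal_distribution (t * sqrt (2 * v)))"
    proof (rule Bochner_Integration.integral_cong)
      fix v
      have "(CLINT z|distr M borel Z. ?f (z, v)) =
        (CLINT z|distr M borel Z. iexp (t * ?c * v) * iexp (t * sqrt (2 * v) * z))"
        by (rule Bochner_Integration.integral_cong) (simp_all add: exp_add[symmetric] algebra_simps)
      then show "(CLINT z|distr M borel Z. ?f (z, v)) = iexp (t * ?c * v) * char std_normal_distribution (t * sqrt (2 * v))"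
        by (simp add: char_def dZ)
    qed simp
    also have "\<dots> = (CLINT v|lborel. indicator {0<..} v *\<^sub>R exp (- ((1 + t\<^sup>2 - \<i> * t * ?c) * of_real v)))"
      unfolding dV
    proof (subst integral_density)
      show "(CLINT v|lborel. exponential_density 1 v *\<^sub>R (iexp (t * ?c * v) * char std_normal_distribution (t * sqrt (2 * v)))) =
        (CLINT v|lborel. indicator {0<..} v *\<^sub>R exp (- ((1 + t\<^sup>2 - \<i> * t * ?c) * of_real v)))"
      proof (rule integral_cong_AE)
        show "AE v in lborel. exponential_density 1 v *\<^sub>R (iexp (t * ?c * v) * char std_normal_distribution (t * sqrt (2 * v))) =
          indicator {0<..} v *\<^sub>R exp (- ((1 + t\<^sup>2 - \<i> * t * ?c) * of_real v))"
          \<comment> \<open>For v > 0 the normal factor is exp(-t^2 v), because (t sqrt(2v))^2 / 2 =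
            t^2 v. For v < 0 both sides vanish, whatever value \<open>sqrt\<close> takes there. At v
            = 0 the exponential density is 1 but the open indicator is 0.\<close>
          using AE_lborel_singleton[of 0]
        proof eventually_elim
          case (elim v)
          show ?case
          proof (cases "v > 0")
            case True
            have "exp (- v) *\<^sub>R (iexp (t * ?c * v) * complex_of_real (exp (- (t\<^sup>2 * v)))) =
              exp (- ((1 + t\<^sup>2 - \<i> * t * ?c) * of_real v))"
              unfolding scaleR_conv_of_real exp_of_real[symmetric] exp_add[symmetric]
              by (rule arg_cong[where f=exp]) (simp add: algebra_simps)
            with True show ?thesis
              by (simp add: exponential_density_def char_std_normal_distribution power_mult_distrib)
          qed (use elim in \<open>simp add: exponential_density_def\<close>)
        qed
      qed (simp_all add: char_std_normal_distribution)
    qed (simp_all add: char_std_normal_distribution)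
    also have "\<dots> = 1 / (1 + t\<^sup>2 - \<i> * t * ?c)"
      by (rule has_bochner_integral_integral_eq, rule has_bochner_integral_exp_Ioi)
         (simp add: add_pos_nonneg)
    also have "\<dots> = (CLINT x|lborel. AL_density 0 1 \<kappa> x *\<^sub>R iexp (t * x))"
      using has_bochner_integral_integral_eq[OF has_bochner_integral_AL_iexp[OF k, of t]] by simp
    also have "\<dots> = char ?D t"
      unfolding char_def by (subst integral_density) (simp_all add: AL_density_nonneg k)
    finally show "char (distr M borel ?Y) t = char ?D t" .
  qed
qed

section \<open>Integration against the law of the mixing variable\<close>

text \<open>A probability law has only countably many atoms. Since the point probabilities sum to 1,
  the atoms carry all the mass, and countable additivity determines the law on every Borel
  set.\<close>

lemma emeasure_distr_discrete:
  fixes W :: "'a \<Rightarrow> real"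
  assumes "prob_space M" and W [measurable]: "W \<in> borel_measurable M"
    and h: "\<And>w. h w \<ge> 0" "\<And>w. measure M {\<omega> \<in> space M. W \<omega> = w} = h w"
    and sum: "(\<integral>\<^sup>+w. ennreal (h w) \<partial>count_space UNIV) = 1"
    and A: "A \<in> sets borel"
  shows "emeasure (distr M borel W) A = (\<integral>\<^sup>+w\<in>A. ennreal (h w) \<partial>count_space UNIV)"
proof -
  interpret prob_space M by fact
  interpret P: prob_space "distr M borel W" by (rule prob_space_distr) simp
  let ?P = "distr M borel W" and ?S = "{w. h w \<noteq> 0}"
  have point: "emeasure ?P {w} = ennreal (h w)" for w
  proof -
    have "W -` {w} \<inter> space M = {\<omega> \<in> space M. W \<omega> = w}" by auto
    then show ?thesis
      by (simp add: emeasure_distr emeasure_eq_measure h(2))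
  qed
  have "countable {w. measure ?P {w} \<noteq> 0}" by (rule P.countable_support)
  moreover have "measure ?P {w} = h w" for w
    using point[of w] h(1)[of w] by (simp add: P.emeasure_eq_measure)
  ultimately have S: "countable ?S" by simp
  have *: "emeasure ?P B = (\<integral>\<^sup>+w\<in>B. ennreal (h w) \<partial>count_space UNIV)" if "B \<subseteq> ?S" for B
    using that countable_subset[OF that S]
    by (subst emeasure_countable_singleton)
       (auto simp: point nn_integral_count_space_indicator mult.commute)
  have "emeasure ?P ?S = (\<integral>\<^sup>+w. ennreal (h w) \<partial>count_space UNIV)"
    by (subst *) (auto intro!: nn_integral_cong simp: indicator_def)
  then have "emeasure ?P ?S = 1" using sum by simp
  moreover have SS: "?S \<in> sets borel" using S by (rule sets.countable[rotated]) simp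
  \<comment> \<open>Full mass on \<open>?S\<close> allows an arbitrary Borel set to be replaced by
    its trace on \<open>?S\<close>, where the countable formula applies.\<close>
  ultimately have "AE w in ?P. w \<in> ?S"
    by (intro P.AE_prob_1) (simp add: P.emeasure_eq_measure)
  then have "emeasure ?P A = emeasure ?P (A \<inter> ?S)"
    using A SS by (intro emeasure_eq_AE) auto
  also have "\<dots> = (\<integral>\<^sup>+w\<in>A. ennreal (h w) \<partial>count_space UNIV)"
    by (subst *) (auto intro!: nn_integral_cong simp: indicator_def)
  finally show ?thesis .
qed

text \<open>This puts the two kinds of mixing function on the same footing, so that no case
  distinction is left in the final argument.\<close>

lemma nn_integral_mixing_law:
  fixes W :: "'a \<Rightarrow> real" and g :: "real \<Rightarrow> ennreal"
  assumes M: "prob_space M" and h: "mixing_function k h" and W: "has_mixing_law k M W h"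
    and g [measurable]: "g \<in> borel_measurable borel"
  shows "(\<integral>\<^sup>+w. g w \<partial>distr M borel W) = (\<integral>\<^sup>+w. ennreal (h w) * g w \<partial>mixing_base k)"
proof (cases k)
  case Density
  then have D: "distributed M lborel W (\<lambda>w. ennreal (h w))" using W by (simp add: has_mixing_law_def)
  have [measurable]: "W \<in> borel_measurable M" using D by (simp add: distributed_def)
  show ?thesis
    using distributed_nn_integral[OF D, of g] Density
    by (simp add: nn_integral_distr mixing_base_def)
next
  case Mass
  have m: "W \<in> borel_measurable M" "\<And>w. measure M {\<omega> \<in> space M. W \<omega> = w} = h w"
    using W Mass by (auto simp: has_mixing_law_def)
  have hh: "\<And>w. h w \<ge> 0" "(\<integral>\<^sup>+w. ennreal (h w) \<partial>count_space UNIV) = 1"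
    using h Mass by (auto simp: mixing_function_def mixing_base_def)
  let ?Q = "density (count_space UNIV) (\<lambda>w. ennreal (h w))"
  \<comment> \<open>\<open>?Q\<close> lives on the sigma-algebra of all sets of reals; its image
    under the identity restricts it to the Borel sets, where it can be compared with the law of
    \<open>W\<close>.\<close>
  have "distr M borel W = distr ?Q borel (\<lambda>w. w)"
  proof (rule measure_eqI)
    fix A assume "A \<in> sets (distr M borel W)"
    then have A: "A \<in> sets borel" by simp
    show "emeasure (distr M borel W) A = emeasure (distr ?Q borel (\<lambda>w. w)) A"
      using emeasure_distr_discrete[OF M m(1) hh(1) m(2) hh(2) A] A
      by (simp add: emeasure_distr emeasure_density)
  qed simp
  then show ?thesis
    by (simp add: nn_integral_distr nn_integral_density mixing_base_def Mass)
qed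

section \<open>Averaging over the mixing variable\<close>

theorem proposition1:
  fixes \<mu> \<beta> \<kappa> :: real
    and k :: mixing_kind
    and h :: "'p \<Rightarrow> real \<Rightarrow> real" and \<theta> :: 'p
    and N :: "'a measure" and X :: "'a \<Rightarrow> real"
    and M :: "'b measure" and Z V W :: "'b \<Rightarrow> real"
  assumes "\<beta> > 0" and "\<kappa> > 0"
    and "mixing_function k (h \<theta>)"
    and "prob_space N" and "has_ALSM_law k N X \<mu> \<beta> \<kappa> (h \<theta>)"
    and "prob_space M"
    and "prob_space.indep_vars M (\<lambda>_. borel) (\<lambda>i. [Z, V, W] ! i) {..<3}"
    and "distributed M lborel Z (\<lambda>z. ennreal (std_normal_density z))"
    and "distributed M lborel V (\<lambda>v. ennreal (exponential_density 1 v))"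
    and "has_mixing_law k M W (h \<theta>)"
  shows "distr N borel X =
         distr M borel (\<lambda>\<omega>. \<mu> + \<beta> * (1 / \<kappa> - \<kappa>) * (V \<omega> / W \<omega>)
                              + \<beta> * (sqrt (2 * V \<omega>) / W \<omega>) * Z \<omega>)"
    (is "_ = distr M borel ?F")
proof -
  interpret M: prob_space M by fact
  note ind = assms(7)
  have rv: "M.random_variable borel ([Z, V, W] ! i)" if "i < 3" for i
    using ind that by (auto simp: M.indep_vars_def)
  have [measurable]: "Z \<in> borel_measurable M" "V \<in> borel_measurable M" "W \<in> borel_measurable M"
    using rv[of 0] rv[of 1] rv[of 2] by auto
  define Y where "Y \<omega> = (1 / \<kappa> - \<kappa>) * V \<omega> + sqrt (2 * V \<omega>) * Z \<omega>" for \<omega>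
  have [measurable]: "Y \<in> borel_measurable M" unfolding Y_def[abs_def] by measurable
  \<comment> \<open>Joint independence is applied to disjoint index blocks: {0} against {1}
    separates \<open>Z\<close> from \<open>V\<close>, and below {0, 1} against {2} separates
    \<open>Y\<close>, a function of the first block, from \<open>W\<close>.\<close>
  have "M.indep_var borel ((\<lambda>x. x (0::nat)) \<circ> (\<lambda>\<omega>. restrict (\<lambda>i. ([Z, V, W] ! i) \<omega>) {0}))
          borel ((\<lambda>x. x (1::nat)) \<circ> (\<lambda>\<omega>. restrict (\<lambda>i. ([Z, V, W] ! i) \<omega>) {1}))"
    by (rule M.indep_var_compose[OF M.indep_var_restrict[OF ind]]) auto
  then have indZV: "M.indep_var borel Z borel V" by (simp add: comp_def)
  have "M.indep_var
          borel ((\<lambda>x. (1 / \<kappa> - \<kappa>) * x 1 + sqrt (2 * x 1) * x (0::nat)) \<circ>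
            (\<lambda>\<omega>. restrict (\<lambda>i. ([Z, V, W] ! i) \<omega>) {0, 1}))
          borel ((\<lambda>x. x (2::nat)) \<circ> (\<lambda>\<omega>. restrict (\<lambda>i. ([Z, V, W] ! i) \<omega>) {2}))"
    by (rule M.indep_var_compose[OF M.indep_var_restrict[OF ind]]) auto
  then have indYW: "M.indep_var borel Y borel W" by (simp add: comp_def Y_def[abs_def])
  have dY: "distr M borel Y = density lborel (AL_density 0 1 \<kappa>)"
    unfolding Y_def[abs_def] by (rule M.normal_exponential_mixture) fact+
  let ?PW = "distr M borel W"
  \<comment> \<open>Integrating against the law of \<open>W\<close> instead of \<^const>\<open>mixing_base\<close> makes Tonelli applicable in the
    discrete case, where counting measure on the reals is not sigma-finite.\<close>
  interpret PW: prob_space ?PW by (rule M.prob_space_distr) simp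
  interpret PY: prob_space "distr M borel Y" by (rule M.prob_space_distr) simp
  interpret YW: pair_prob_space "distr M borel Y" ?PW ..
  interpret LW: pair_sigma_finite lborel ?PW ..
  have [simp]: "h \<theta> w \<ge> 0" for w using assms(3) by (simp add: mixing_function_def)
  have pos: "w > 0" if "h \<theta> w \<noteq> 0" for w
    using assms(3) that by (auto simp: mixing_function_def mixing_support_def)
  note law = nn_integral_mixing_law[OF assms(6) assms(3) assms(10)]
  \<comment> \<open>Since \<open>h \<theta>\<close> vanishes on \<open>{..0}\<close>, this set is
    null for the law of \<open>W\<close>. The scale \<beta>/w is thus almost surely positive, as the
    change of variables below requires.\<close>
  have PWpos: "AE w in ?PW. w > 0"
  proof -
    have "(\<integral>\<^sup>+w. indicator {..0} w \<partial>?PW) = (\<integral>\<^sup>+w. ennreal (h \<theta> w) * indicator {..0} w \<partial>mixing_base k)"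
      by (rule law) simp
    also have "\<dots> = 0"
      using pos by (intro nn_integral_zero') (fastforce simp: indicator_def intro!: AE_I2)
    finally have "emeasure ?PW {..0} = 0" by simp
    then show ?thesis
      by (intro AE_I[of _ _ "{..0}"]) auto
  qed
  have AL_meas [measurable]: "(\<lambda>(x, w). AL_density \<mu> (\<beta> / w) \<kappa> x) \<in> borel_measurable (borel \<Otimes>\<^sub>M borel)"
    unfolding AL_density_def by measurable
  \<comment> \<open>The factor \<open>h \<theta> w\<close> is already 0 off the support, so the
    restricted integral is an average over the law of \<open>W\<close>.\<close>
  have ALSM: "ALSM_density k \<mu> \<beta> \<kappa> (h \<theta>) x = (\<integral>\<^sup>+w. AL_density \<mu> (\<beta> / w) \<kappa> x \<partial>?PW)" for x
  proof -
    have "(\<integral>\<^sup>+w. AL_density \<mu> (\<beta> / w) \<kappa> x \<partial>?PW) =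
        (\<integral>\<^sup>+w. ennreal (h \<theta> w) * ennreal (AL_density \<mu> (\<beta> / w) \<kappa> x) \<partial>mixing_base k)"
      by (rule law) simp
    then show ?thesis
      unfolding ALSM_density_def
      by (auto intro!: nn_integral_cong
          simp: mixing_support_def indicator_def ennreal_mult' mult.commute)
  qed
  have F: "?F \<omega> = \<mu> + \<beta> / W \<omega> * Y \<omega>" for \<omega>
    by (simp add: Y_def algebra_simps)
  show ?thesis
  proof (rule measure_eqI)
    fix A assume "A \<in> sets (distr N borel X)"
    then have A [measurable]: "A \<in> sets borel" by simp
    have "emeasure (distr M borel ?F) A = (\<integral>\<^sup>+\<omega>. indicator A (?F \<omega>) \<partial>M)"
      by (simp flip: nn_integral_indicator add: nn_integral_distr)
    also have "\<dots> = (\<integral>\<^sup>+p. indicator A (\<mu> + \<beta> / snd p * fst p) \<partial>distr M (borel \<Otimes>\<^sub>M borel) (\<lambda>\<omega>. (Y \<omega>, W \<omega>)))"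
      unfolding F by (subst nn_integral_distr) simp_all
    also have "\<dots> = (\<integral>\<^sup>+p. indicator A (\<mu> + \<beta> / snd p * fst p) \<partial>(distr M borel Y \<Otimes>\<^sub>M ?PW))"
      using indYW by (simp add: M.indep_var_distribution_eq)
    also have "\<dots> = (\<integral>\<^sup>+w. \<integral>\<^sup>+y. indicator A (\<mu> + \<beta> / w * y) \<partial>distr M borel Y \<partial>?PW)"
      by (subst YW.nn_integral_snd[symmetric]) simp_all
    also have "\<dots> = (\<integral>\<^sup>+w. \<integral>\<^sup>+x. ennreal (AL_density \<mu> (\<beta> / w) \<kappa> x) * indicator A x \<partial>lborel \<partial>?PW)"
    proof (rule nn_integral_cong_AE)
      show "AE w in ?PW. (\<integral>\<^sup>+y. indicator A (\<mu> + \<beta> / w * y) \<partial>distr M borel Y) =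
          (\<integral>\<^sup>+x. ennreal (AL_density \<mu> (\<beta> / w) \<kappa> x) * indicator A x \<partial>lborel)"
        using PWpos
      proof eventually_elim
        case (elim w)
        then have b: "\<beta> / w > 0" using \<open>\<beta> > 0\<close> by simp
        \<comment> \<open>The substitution x = \<mu> + (\<beta>/w) y produces the Jacobian
          \<beta>/w, which \<open>AL_density_affine\<close> absorbs to leave the density of
          \<open>Y\<close>.\<close>
        have "(\<integral>\<^sup>+x. ennreal (AL_density \<mu> (\<beta> / w) \<kappa> x) * indicator A x \<partial>lborel) =
          (\<integral>\<^sup>+y. ennreal (\<beta> / w) * (ennreal (AL_density \<mu> (\<beta> / w) \<kappa> (\<mu> + \<beta> / w * y)) * indicator A (\<mu> + \<beta> / w * y)) \<partial>lborel)"
          using b by (subst nn_integral_real_affine[of _ "\<beta> / w" \<mu>]) (use elim \<open>\<beta> > 0\<close> in \<open>simp_all add: nn_integral_cmult abs_of_pos del: abs_divide\<close>)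
        also have "\<dots> = (\<integral>\<^sup>+y. ennreal (AL_density 0 1 \<kappa> y) * indicator A (\<mu> + \<beta> / w * y) \<partial>lborel)"
          unfolding AL_density_affine[OF b, of \<mu> \<kappa>, symmetric] using b
          by (simp only: ennreal_mult' less_imp_le mult.assoc)
        also have "\<dots> = (\<integral>\<^sup>+y. indicator A (\<mu> + \<beta> / w * y) \<partial>distr M borel Y)"
          unfolding dY by (subst nn_integral_density) simp_all
        finally show ?case ..
      qed
    qed
    \<comment> \<open>Tonelli moves the average over \<open>W\<close> inside, where it turns the
      conditional densities into the mixture density at x.\<close>
    also have "\<dots> = (\<integral>\<^sup>+x. \<integral>\<^sup>+w. ennreal (AL_density \<mu> (\<beta> / w) \<kappa> x) * indicator A x \<partial>?PW \<partial>lborel)"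
      by (rule LW.Fubini') (simp add: split_beta)
    also have "\<dots> = (\<integral>\<^sup>+x. ALSM_density k \<mu> \<beta> \<kappa> (h \<theta>) x * indicator A x \<partial>lborel)"
      by (simp add: ALSM nn_integral_multc)
    also have "\<dots> = emeasure (distr N borel X) A"
    proof -
      have D: "distributed N lborel X (ALSM_density k \<mu> \<beta> \<kappa> (h \<theta>))"
        using assms(5) by (simp add: has_ALSM_law_def)
      have "distr N borel X = distr N lborel X" by (rule distr_cong) simp_all
      also have "\<dots> = density lborel (ALSM_density k \<mu> \<beta> \<kappa> (h \<theta>))"
        using D by (rule distributed_distr_eq_density)
      finally show ?thesis
        using distributed_borel_measurable[OF D] by (simp add: emeasure_density)
    qed
    finally show "emeasure (distr N borel X) A = emeasure (distr M borel ?F) A" ..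
  qed simp
qed

end
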